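(* Let $d\ge 1$ and let $Y\subseteq\mathcal A^{\mathbb Z^d}$ be a subshift. Then the problem "$Y\subseteq X$ on SFT inputs $X$" is enumeration-equivalent to $\mathcal L(Y)^c$; that is, there exists a computable function which maps any enumeration of $\mathcal L(Y)^c$ to an enumeration of all SFTs $X$ such that $Y\subseteq X$, and conversely there exists a computable function which maps any enumeration of all SFTs $X$ such that $Y\subseteq X$ to an enumeration of $\mathcal L(Y)^c$.
   Context: Alphabets are finite (taken as finite subsets of $\mathbb N$, so that finite data can be coded). For $u\in\mathbb Z^d$ and $x\in\mathcal A^{\mathbb Z^d}$, the shift is $\sigma^u(x)(v)=x(v+u)$. A pattern is a function $p\colon S\to\mathcal A$ with $S\subset\mathbb Z^d$ finite; it appears in $x$ if $\sigma^u(x)|_S=p$ for some $u\in\mathbb Z^d$. A subshift is a (possibly empty) topologically closed, shift-invariant subset of $\mathcal A^{\mathbb Z^d}$ (product topology of the discrete topology). For a set $\mathcal F$ of patterns, $X_{\mathcal F}=\{x\in\mathcal A^{\mathbb Z^d}: \text{no pattern of }\mathcal F\text{ appears in }x\}$; a subshift is of finite type (SFT) if it equals $X_{\mathcal F}$ for a finite $\mathcal F$. The language $\mathcal L(Y)$ is the set of patterns that appear in some configuration of $Y$, and $\mathcal L(Y)^c$ is its complement in the set of patterns. SFTs are presented by an alphabet and a finite set of forbidden patterns; an enumeration of a collection of SFTs is an enumeration of such presentations. The subshift $Y$ is a fixed parameter, with no computability assumption. "The problem $Y\subseteq X$ on SFT inputs" is: given an SFT $X$ (same dimension $d$), determine whether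 $Y\subseteq X$. *)

theory Defs
  imports "HOL-Analysis.Function_Topology" "HOL-Library.Nat_Bijection"
begin

section \<open>Configurations, patterns, subshifts\<close>

text \<open>A point of \<open>\<int>\<^sup>d\<close> is an integer list of length \<open>d\<close>. A configuration over the alphabet \<open>A\<close> is an
  element of the extensional function space \<open>Zgrid d \<rightarrow>\<^sub>E A\<close>, so that configurations over different
  alphabets are comparable.\<close>

definition Zgrid :: "nat \<Rightarrow> int list set" where
  "Zgrid d = {v. length v = d}"

type_synonym config = "int list \<Rightarrow> nat"
type_synonym pattern = "int list \<rightharpoonup> nat"

definition shift :: "nat \<Rightarrow> int list \<Rightarrow> config \<Rightarrow> config" where
  "shift d u x = (\<lambda>v\<in>Zgrid d. x (map2 (+) v u))"

definition patterns :: "nat \<Rightarrow> nat set \<Rightarrow> pattern set" where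
  "patterns d A = {p. finite (dom p) \<and> dom p \<subseteq> Zgrid d \<and> ran p \<subseteq> A}"

definition appears :: "nat \<Rightarrow> pattern \<Rightarrow> config \<Rightarrow> bool" where
  "appears d p x \<longleftrightarrow> (\<exists>u\<in>Zgrid d. (Some \<circ> shift d u x) |` dom p = p)"

definition subshift :: "nat \<Rightarrow> nat set \<Rightarrow> config set \<Rightarrow> bool" where
  "subshift d A Y \<longleftrightarrow>
     closedin (product_topology (\<lambda>_. discrete_topology A) (Zgrid d)) Y \<and>
     (\<forall>u\<in>Zgrid d. \<forall>x\<in>Y. shift d u x \<in> Y)"

definition language :: "nat \<Rightarrow> nat set \<Rightarrow> config set \<Rightarrow> pattern set" where
  "language d A Y = {p \<in> patterns d A. \<exists>x\<in>Y. appears d p x}"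

text \<open>An SFT is presented by a finite alphabet together with a finite set of forbidden patterns over
  that alphabet; its alphabet is not tied to that of any other subshift.\<close>

type_synonym presentation = "nat set \<times> pattern set"

definition sft_presentations :: "nat \<Rightarrow> presentation set" where
  "sft_presentations d = {(B, F). finite B \<and> finite F \<and> F \<subseteq> patterns d B}"

definition sft :: "nat \<Rightarrow> presentation \<Rightarrow> config set" where
  "sft d = (\<lambda>(B, F). {x \<in> Zgrid d \<rightarrow>\<^sub>E B. \<forall>p\<in>F. \<not> appears d p x})"


section \<open>Coding of finite objects by natural numbers\<close>

definition pattern_code :: "pattern \<Rightarrow> nat" where
  "pattern_code p =
     set_encode ((\<lambda>(v, a). prod_encode (list_encode (map int_encode v), a)) ` Map.graph p)"

definition presentation_code :: "presentation \<Rightarrow> nat" where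
  "presentation_code = (\<lambda>(B, F). prod_encode (set_encode B, set_encode (pattern_code ` F)))"

lemma inj_on_pattern_code: "inj_on pattern_code (patterns d A)"
proof (rule inj_onI)
  fix p q assume p: "p \<in> patterns d A" and q: "q \<in> patterns d A"
    and eq: "pattern_code p = pattern_code q"
  let ?c = "\<lambda>(v, a). prod_encode (list_encode (map int_encode v), a)"
  have fin: "finite (Map.graph p)" "finite (Map.graph q)"
    using p q by (auto simp: patterns_def)
  have inj: "inj ?c"
    by (auto intro!: injI simp: list_encode_eq inj_map_eq_map[OF inj_int_encode])
  have "?c ` Map.graph p = ?c ` Map.graph q"
    using eq fin unfolding pattern_code_def
    by (simp add: set_encode_eq)
  then have "Map.graph p = Map.graph q"
    by (rule inj_image_eq_iff[OF inj, THEN iffD1])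
  then have *: "p v = Some a \<longleftrightarrow> q v = Some a" for v a
    by (auto simp: set_eq_iff Map.graph_def)
  show "p = q"
  proof
    fix v show "p v = q v"
      by (metis * not_Some_eq)
  qed
qed

lemma inj_on_presentation_code: "inj_on presentation_code (sft_presentations d)"
proof (rule inj_onI, clarify)
  fix B F B' F'
  assume "(B, F) \<in> sft_presentations d" "(B', F') \<in> sft_presentations d"
    and eq: "presentation_code (B, F) = presentation_code (B', F')"
  then have fin: "finite B" "finite B'" "finite F" "finite F'"
    and FF: "F \<subseteq> patterns d UNIV" "F' \<subseteq> patterns d UNIV"
    by (auto simp: sft_presentations_def patterns_def)
  have "B = B'" "pattern_code ` F = pattern_code ` F'"
    using eq fin unfolding presentation_code_def
    by (simp_all add: set_encode_eq)
  then show "B = B' \<and> F = F'"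
    using inj_on_image_eq_iff[OF inj_on_pattern_code FF] by simp
qed


section \<open>Computation relative to a function\<close>

text \<open>Partial recursive functions relative to a function \<open>f\<close> on naturals: \<open>computes f p xs y\<close> says that
  program \<open>p\<close>, able to query values of \<open>f\<close>, halts on the arguments \<open>xs\<close> with value \<open>y\<close>. Where no rule
  applies the computation is undefined.\<close>

datatype prog =
    Zero | Succ | Proj nat | Query
  | Comp prog "prog list" | PrimRec prog prog | Mu prog

inductive computes :: "(nat \<Rightarrow> nat) \<Rightarrow> prog \<Rightarrow> nat list \<Rightarrow> nat \<Rightarrow> bool" for f where
  zero: "computes f Zero xs 0"
| succ: "computes f Succ [x] (Suc x)"
| proj: "i < length xs \<Longrightarrow> computes f (Proj i) xs (xs ! i)"
| query: "computes f Query [x] (f x)"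
| comp: "list_all2 (\<lambda>g y. computes f g xs y) gs ys \<Longrightarrow> computes f h ys z
    \<Longrightarrow> computes f (Comp h gs) xs z"
| prim_zero: "computes f g xs y \<Longrightarrow> computes f (PrimRec g h) (0 # xs) y"
| prim_Suc: "computes f (PrimRec g h) (n # xs) r \<Longrightarrow> computes f h (n # r # xs) y
    \<Longrightarrow> computes f (PrimRec g h) (Suc n # xs) y"
| mu: "computes f g (n # xs) 0 \<Longrightarrow> \<forall>m<n. \<exists>y. computes f g (m # xs) (Suc y)
    \<Longrightarrow> computes f (Mu g) xs n"

inductive_cases computesE:
  "computes f Zero xs y" "computes f Succ xs y" "computes f (Proj i) xs y" "computes f Query xs y"
  "computes f (Comp h gs) xs y" "computes f (PrimRec g h) (0 # xs) y"
  "computes f (PrimRec g h) (Suc n # xs) y" "computes f (Mu g) xs y"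

lemma computes_deterministic: "computes f p xs y \<Longrightarrow> computes f p xs z \<Longrightarrow> y = z"
proof (induction arbitrary: z rule: computes.induct)
  case (zero xs)
  then show ?case by (rule computesE(1)) simp
next
  case (succ x)
  then show ?case by (rule computesE(2)) simp
next
  case (proj i xs)
  from proj.prems show ?case by (rule computesE(3)) simp
next
  case (query x)
  then show ?case by (rule computesE(4)) simp
next
  case (comp xs gs ys h w)
  from comp.prems obtain ys' where ys': "list_all2 (\<lambda>g y. computes f g xs y) gs ys'"
    and z: "computes f h ys' z"
    by (rule computesE(5))
  have all: "list_all2 (\<lambda>g y. \<forall>z. computes f g xs z \<longrightarrow> y = z) gs ys"
    using comp.IH(1) by (rule list_all2_mono) simp
  have "ys = ys'"
  proof (rule nth_equalityI)
    show len: "length ys = length ys'"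
      using list_all2_lengthD[OF all] list_all2_lengthD[OF ys'] by simp
    fix i assume i: "i < length ys"
    show "ys ! i = ys' ! i"
      using list_all2_nthD2[OF all i] list_all2_nthD2[OF ys' i[unfolded len]] by simp
  qed
  with z have "computes f h ys z" by simp
  then show ?case by (rule comp.IH(2))
next
  case (prim_zero g xs y h)
  from prim_zero.prems show ?case by (rule computesE(6)) (rule prim_zero.IH)
next
  case (prim_Suc g h n xs r y)
  from prim_Suc.prems obtain r' where "computes f (PrimRec g h) (n # xs) r'"
    "computes f h (n # r' # xs) z"
    by (rule computesE(7))
  with prim_Suc.IH(1) have "computes f h (n # r # xs) z" by simp
  then show ?case by (rule prim_Suc.IH(2))
next
  case (mu g n xs)
  from mu.prems obtain z: "computes f g (z # xs) 0" "\<forall>m<z. \<exists>y. computes f g (m # xs) (Suc y)"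
    by (rule computesE(8))
  have "\<not> n < z"
  proof
    assume "n < z"
    then obtain y where "computes f g (n # xs) (Suc y)" using z(2) by blast
    from mu.IH(1)[OF this] show False by simp
  qed
  moreover have "\<not> z < n"
  proof
    assume "z < n"
    then obtain y where "\<forall>w. computes f g (z # xs) w \<longrightarrow> Suc y = w" using mu.IH(2) by auto
    with z(1) show False by auto
  qed
  ultimately show ?case by simp
qed

text \<open>A function taking sequences in \<open>D\<close> to sequences is computable if one program, independent of the
  input sequence, produces all terms of the output sequence.\<close>

definition computable_on :: "(nat \<Rightarrow> nat) set \<Rightarrow> ((nat \<Rightarrow> nat) \<Rightarrow> (nat \<Rightarrow> nat)) \<Rightarrow> bool" where
  "computable_on D \<Phi> \<longleftrightarrow> (\<exists>p. \<forall>f\<in>D. \<forall>n. computes f p [n] (\<Phi> f n))"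


section \<open>Enumerations\<close>

text \<open>An enumeration of \<open>S\<close> lists its elements in any order and with repetitions; the value \<open>0\<close> means
  that nothing is listed at this step, and \<open>Suc n\<close> that \<open>n\<close> is listed. The silent steps are what allows
  the empty set to be enumerated.\<close>

definition enumerates :: "(nat \<Rightarrow> nat) \<Rightarrow> nat set \<Rightarrow> bool" where
  "enumerates e S \<longleftrightarrow> S = {n. Suc n \<in> range e}"

definition enum_reducible :: "nat set \<Rightarrow> nat set \<Rightarrow> bool" where
  "enum_reducible S T \<longleftrightarrow>
     (\<exists>\<Phi>. computable_on {e. enumerates e T} \<Phi> \<and> (\<forall>e. enumerates e T \<longrightarrow> enumerates (\<Phi> e) S))"

definition enum_equivalent :: "nat set \<Rightarrow> nat set \<Rightarrow> bool" where
  "enum_equivalent S T \<longleftrightarrow> enum_reducible S T \<and> enum_reducible T S"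

end

theory Submission
  imports Defs
begin

text \<open>Whether \<open>Y\<close> is contained in an SFT depends on finitely many patterns only: \<open>Y \<subseteq> (B, F)\<close> iff every
  pattern of \<open>F\<close> with symbols in \<open>A\<close>, and every one-cell pattern with symbol in \<open>A - B\<close>, lies outside
  \<open>language d A Y\<close>. Hence an enumeration of the complement of the language is turned into an enumeration
  of the SFTs containing \<open>Y\<close> by listing \<open>(B, F)\<close> as soon as all these patterns have been listed. Conversely
  a pattern \<open>p\<close> over \<open>A\<close> lies outside the language iff \<open>(A, {p})\<close> contains \<open>Y\<close>, so it suffices to
  extract the presentations of this form.\<close>

section \<open>Closure properties of relative computability\<close>

text \<open>Terms and formulas are functions of the queried function and of a list of \<open>k\<close> arguments. Under a
  binder the bound variable is the head of the argument list, so that variables are de Bruijn indices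
  \<open>hd xs\<close>, \<open>hd (tl xs)\<close>, and so on.\<close>

definition rel_computable :: "nat \<Rightarrow> ((nat \<Rightarrow> nat) \<Rightarrow> nat list \<Rightarrow> nat) \<Rightarrow> bool" where
  "rel_computable k E \<longleftrightarrow> (\<exists>p. \<forall>f xs. length xs = k \<longrightarrow> computes f p xs (E f xs))"

text \<open>The value \<open>0\<close> stands for truth, as in the unbounded search \<^term>\<open>Mu\<close>.\<close>

definition rel_decidable :: "nat \<Rightarrow> ((nat \<Rightarrow> nat) \<Rightarrow> nat list \<Rightarrow> bool) \<Rightarrow> bool" where
  "rel_decidable k P \<longleftrightarrow> rel_computable k (\<lambda>f xs. if P f xs then 0 else 1)"

lemma rel_computable_const: "rel_computable k (\<lambda>f xs. c)"
proof (induction c)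
  case 0
  show ?case unfolding rel_computable_def by (blast intro: computes.zero)
next
  case (Suc c)
  then obtain p where "computes f p xs c" if "length xs = k" for f xs
    unfolding rel_computable_def by blast
  then have "computes f (Comp Succ [p]) xs (Suc c)" if "length xs = k" for f xs
    using that by (intro computes.comp[where ys = "[c]"]) (auto intro: computes.succ)
  then show ?case unfolding rel_computable_def by blast
qed

lemma rel_computable_nth: "i < k \<Longrightarrow> rel_computable k (\<lambda>f xs. xs ! i)"
  unfolding rel_computable_def by (blast intro: computes.proj)

text \<open>Projections in the de Bruijn form; the simplified instances for small \<open>i\<close>
  then match variable occurrences syntactically.\<close>

lemma rel_computable_var: "i < k \<Longrightarrow> rel_computable k (\<lambda>f xs. hd ((tl ^^ i) xs))"
proof -
  assume i: "i < k"
  have "hd ((tl ^^ i) xs) = xs ! i" if "length xs = k" for xs :: "nat list"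
  proof -
    have "(tl ^^ i) xs = drop i xs" by (induction i) (simp_all add: drop_Suc tl_drop)
    then show ?thesis using that i by (simp add: hd_drop_conv_nth)
  qed
  then show ?thesis
    using rel_computable_nth[OF i] unfolding rel_computable_def by simp
qed

text \<open>Weakening: a term moved under a binder ignores the new head variable. Composition with
  the projections from index 1 on drops it.\<close>

lemma rel_computable_tl:
  assumes "rel_computable k X" shows "rel_computable (Suc k) (\<lambda>f ys. X f (tl ys))"
proof -
  obtain p where p: "length xs = k \<Longrightarrow> computes f p xs (X f xs)" for f xs
    using assms unfolding rel_computable_def by blast
  have "computes f (Comp p (map Proj [1..<Suc k])) ys (X f (tl ys))"
    if len: "length ys = Suc k" for f ys
  proof (rule computes.comp)
    show "list_all2 (\<lambda>g y. computes f g ys y) (map Proj [1..<Suc k]) (tl ys)"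
      using len by (auto simp: list_all2_conv_all_nth nth_tl simp del: upt_Suc intro!: computes.proj)
    show "computes f p (tl ys) (X f (tl ys))"
      using p[of "tl ys" f] len by simp
  qed
  then show ?thesis unfolding rel_computable_def by blast
qed

text \<open>Substitution: it suffices to program an operation on bare variables, and closure under
  arbitrary argument terms follows.\<close>

lemma rel_computable_comp1:
  assumes "rel_computable 1 (\<lambda>f xs. G f (hd xs))" and "rel_computable k X"
  shows "rel_computable k (\<lambda>f xs. G f (X f xs))"
proof -
  obtain p q where p: "length xs = 1 \<Longrightarrow> computes f p xs (G f (hd xs))"
    and q: "length xs = k \<Longrightarrow> computes f q xs (X f xs)" for f xs
    using assms unfolding rel_computable_def by metis
  have "computes f (Comp p [q]) xs (G f (X f xs))" if "length xs = k" for f xs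
    using q[OF that, of f] p[of "[X f xs]" f] by (intro computes.comp[where ys = "[X f xs]"]) auto
  then show ?thesis unfolding rel_computable_def by blast
qed

lemma rel_computable_comp2:
  assumes "rel_computable 2 (\<lambda>f xs. G f (hd xs) (hd (tl xs)))"
    and "rel_computable k X" and "rel_computable k Y"
  shows "rel_computable k (\<lambda>f xs. G f (X f xs) (Y f xs))"
proof -
  obtain p q r where p: "length xs = 2 \<Longrightarrow> computes f p xs (G f (hd xs) (hd (tl xs)))"
    and q: "length xs = k \<Longrightarrow> computes f q xs (X f xs)"
    and r: "length xs = k \<Longrightarrow> computes f r xs (Y f xs)" for f xs
    using assms unfolding rel_computable_def by metis
  have "computes f (Comp p [q, r]) xs (G f (X f xs) (Y f xs))" if "length xs = k" for f xs
    using q[OF that, of f] r[OF that, of f] p[of "[X f xs, Y f xs]" f]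
    by (intro computes.comp[where ys = "[X f xs, Y f xs]"]) auto
  then show ?thesis unfolding rel_computable_def by blast
qed

lemmas rel_decidable_comp2 =
  rel_computable_comp2[where G = "\<lambda>f x y. if Q f x y then 0 else 1" for Q, folded rel_decidable_def]

lemma rel_computable_Suc:
  assumes "rel_computable k X" shows "rel_computable k (\<lambda>f xs. Suc (X f xs))"
proof (rule rel_computable_comp1[where G = "\<lambda>f. Suc", OF _ assms])
  have "computes f Succ xs (Suc (hd xs))" if "length xs = 1" for f xs
    using that computes.succ by (cases xs) auto
  then show "rel_computable 1 (\<lambda>f xs. Suc (hd xs))" unfolding rel_computable_def by blast
qed

lemma rel_computable_query:
  assumes "rel_computable k X" shows "rel_computable k (\<lambda>f xs. f (X f xs))"
proof (rule rel_computable_comp1[where G = "\<lambda>f x. f x", OF _ assms])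
  have "computes f Query xs (f (hd xs))" if "length xs = 1" for f xs
    using that computes.query by (cases xs) auto
  then show "rel_computable 1 (\<lambda>f xs. f (hd xs))" unfolding rel_computable_def by blast
qed

text \<open>\<open>PrimRec\<close> puts the counter and the previous value in front of the
  parameters, so the step reads them as the first two variables and finds the parameters in the
  double tail.\<close>

lemma rel_computable_rec:
  assumes "rel_computable k Z"
    and "rel_computable (Suc (Suc k)) (\<lambda>f ys. S f (tl (tl ys)) (hd ys) (hd (tl ys)))"
    and "rel_computable k N"
  shows "rel_computable k (\<lambda>f xs. rec_nat (Z f xs) (\<lambda>n r. S f xs n r) (N f xs))"
proof -
  obtain p q r where p: "length xs = k \<Longrightarrow> computes f p xs (Z f xs)"
    and q: "length ys = Suc (Suc k) \<Longrightarrow> computes f q ys (S f (tl (tl ys)) (hd ys) (hd (tl ys)))"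
    and r: "length xs = k \<Longrightarrow> computes f r xs (N f xs)" for f xs ys
    using assms unfolding rel_computable_def by metis
  have "computes f (Comp (PrimRec p q) (r # map Proj [0..<k])) xs
      (rec_nat (Z f xs) (\<lambda>n r. S f xs n r) (N f xs))" if len: "length xs = k" for f xs
  proof (rule computes.comp)
    have "list_all2 (\<lambda>g y. computes f g xs y) (map Proj [0..<k]) xs"
      using len by (auto simp: list_all2_conv_all_nth intro: computes.proj)
    then show "list_all2 (\<lambda>g y. computes f g xs y) (r # map Proj [0..<k]) (N f xs # xs)"
      using r[OF len] by simp
    have "computes f (PrimRec p q) (n # xs) (rec_nat (Z f xs) (\<lambda>n r. S f xs n r) n)" for n
    proof (induction n)
      case 0
      then show ?case using p[OF len] by (simp add: computes.prim_zero)
    next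
      case (Suc n)
      show ?case
        using q[of "n # rec_nat (Z f xs) (\<lambda>n r. S f xs n r) n # xs" f] len
        by (auto intro: computes.prim_Suc[OF Suc])
    qed
    then show "computes f (PrimRec p q) (N f xs # xs) (rec_nat (Z f xs) (\<lambda>n r. S f xs n r) (N f xs))" .
  qed
  then show ?thesis unfolding rel_computable_def by blast
qed

text \<open>\<open>Mu\<close> finds the first zero of the characteristic function; at every earlier
  argument that function has the value 1 = \<open>Suc 0\<close>, as the rule \<open>mu\<close>
  demands. The hypothesis \<open>ex\<close> makes the search halt for every \<open>f\<close>, since
  \<open>rel_computable\<close> allows no divergence.\<close>

lemma rel_computable_Least:
  assumes "rel_decidable (Suc k) (\<lambda>f ys. P f (tl ys) (hd ys))" and ex: "\<And>f xs. \<exists>n. P f xs n"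
  shows "rel_computable k (\<lambda>f xs. LEAST n. P f xs n)"
proof -
  obtain p where p: "computes f p ys (if P f (tl ys) (hd ys) then 0 else 1)"
    if "length ys = Suc k" for f ys
    using assms(1) unfolding rel_decidable_def rel_computable_def by blast
  have "computes f (Mu p) xs (LEAST n. P f xs n)" if len: "length xs = k" for f xs
  proof (rule computes.mu)
    show "computes f p ((LEAST n. P f xs n) # xs) 0"
      using p[of "(LEAST n. P f xs n) # xs" f] len LeastI_ex[OF ex[of f xs]] by simp
    show "\<forall>m<LEAST n. P f xs n. \<exists>y. computes f p (m # xs) (Suc y)"
    proof (intro allI impI)
      fix m assume "m < (LEAST n. P f xs n)"
      then have "\<not> P f xs m" by (rule not_less_Least)
      then show "\<exists>y. computes f p (m # xs) (Suc y)"
        using p[of "m # xs" f] len by (intro exI[of _ 0]) simp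
    qed
  qed
  then show ?thesis unfolding rel_computable_def by blast
qed

lemmas rel_computable_vars =
  rel_computable_var[of 0, simplified] rel_computable_var[of "Suc 0", simplified]
  rel_computable_var[of "Suc (Suc 0)", simplified] rel_computable_var[of "Suc (Suc (Suc 0))", simplified]
  rel_computable_var[of "Suc (Suc (Suc (Suc 0)))", simplified]

lemmas rel_basic =
  rel_computable_const rel_computable_vars rel_computable_Suc rel_computable_query
  rel_computable_rec

section \<open>Arithmetic, connectives and bounded quantifiers\<close>

lemma rel_computable_add:
  assumes "rel_computable k X" "rel_computable k Y"
  shows "rel_computable k (\<lambda>f xs. X f xs + Y f xs)"
proof (rule rel_computable_comp2[where G = "\<lambda>f. (+)", OF _ assms])
  have "rec_nat y (\<lambda>_ r. Suc r) x = x + y" for x y :: nat by (induction x) auto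
  moreover have "rel_computable 2 (\<lambda>f xs. rec_nat (hd (tl xs)) (\<lambda>_ r. Suc r) (hd xs))"
    by (intro rel_basic) simp_all
  ultimately show "rel_computable 2 (\<lambda>f xs. hd xs + hd (tl xs))" by simp
qed

lemma rel_computable_mult:
  assumes "rel_computable k X" "rel_computable k Y"
  shows "rel_computable k (\<lambda>f xs. X f xs * Y f xs)"
proof (rule rel_computable_comp2[where G = "\<lambda>f. (*)", OF _ assms])
  have "rec_nat 0 (\<lambda>_ r. r + y) x = x * y" for x y :: nat by (induction x) auto
  moreover have "rel_computable 2 (\<lambda>f xs. rec_nat 0 (\<lambda>_ r. r + hd (tl xs)) (hd xs))"
    by (intro rel_basic rel_computable_add) simp_all
  ultimately show "rel_computable 2 (\<lambda>f xs. hd xs * hd (tl xs))" by simp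
qed

lemma rel_computable_power:
  assumes "rel_computable k X" "rel_computable k Y"
  shows "rel_computable k (\<lambda>f xs. X f xs ^ Y f xs)"
proof (rule rel_computable_comp2[where G = "\<lambda>f. (^)", OF _ assms])
  have "rec_nat 1 (\<lambda>_ r. r * x) y = x ^ y" for x y :: nat by (induction y) auto
  moreover have "rel_computable 2 (\<lambda>f xs. rec_nat 1 (\<lambda>_ r. r * hd xs) (hd (tl xs)))"
    by (intro rel_basic rel_computable_mult) simp_all
  ultimately show "rel_computable 2 (\<lambda>f xs. hd xs ^ hd (tl xs))" by simp
qed

lemma rel_computable_diff:
  assumes "rel_computable k X" "rel_computable k Y"
  shows "rel_computable k (\<lambda>f xs. X f xs - Y f xs)"
proof (rule rel_computable_comp2[where G = "\<lambda>f. (-)", OF _ assms])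
  \<comment> \<open>A recursion that returns its counter is the predecessor; iterating it gives
    truncated subtraction.\<close>
  have pred: "rec_nat 0 (\<lambda>n _. n) x = x - 1" for x :: nat by (cases x) auto
  have "rec_nat x (\<lambda>_ r. rec_nat 0 (\<lambda>n _. n) r) y = x - y" for x y :: nat
    by (induction y) (simp_all add: pred)
  moreover have "rel_computable 2 (\<lambda>f xs. rec_nat (hd xs) (\<lambda>_ r. rec_nat 0 (\<lambda>n _. n) r) (hd (tl xs)))"
    by (intro rel_basic) simp_all
  ultimately show "rel_computable 2 (\<lambda>f xs. hd xs - hd (tl xs))" by simp
qed

lemma rel_computable_if:
  assumes "rel_decidable k P" "rel_computable k X" "rel_computable k Y"
  shows "rel_computable k (\<lambda>f xs. if P f xs then X f xs else Y f xs)"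
proof -
  let ?c = "\<lambda>f xs. if P f xs then 0 else (1::nat)"
  \<comment> \<open>Truth values are 0 and 1, so the case distinction is a weighted sum; both
    branches are evaluated, which is harmless because both are total.\<close>
  have "rel_computable k (\<lambda>f xs. (1 - ?c f xs) * X f xs + ?c f xs * Y f xs)"
    using assms unfolding rel_decidable_def
    by (intro rel_computable_add rel_computable_mult rel_computable_diff rel_computable_const)
  moreover have "(1 - ?c f xs) * X f xs + ?c f xs * Y f xs = (if P f xs then X f xs else Y f xs)"
    for f xs
    by simp
  ultimately show ?thesis by simp
qed

lemma rel_decidable_le:
  assumes "rel_computable k X" "rel_computable k Y"
  shows "rel_decidable k (\<lambda>f xs. X f xs \<le> Y f xs)"
proof (rule rel_decidable_comp2[where Q = "\<lambda>f. (\<le>)", OF _ assms])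
  \<comment> \<open>The truncated difference \<open>Suc y - x\<close> is positive exactly when
    \<open>x \<le> y\<close>; subtracting it from 1 yields 0 for truth.\<close>
  have "(if x \<le> y then 0 else 1) = 1 - (Suc y - x)" for x y :: nat by simp
  moreover have "rel_computable 2 (\<lambda>f xs. 1 - (Suc (hd (tl xs)) - hd xs))"
    by (intro rel_basic rel_computable_diff) simp_all
  ultimately show "rel_decidable 2 (\<lambda>f xs. hd xs \<le> hd (tl xs))"
    unfolding rel_decidable_def by simp
qed

lemma rel_decidable_not:
  assumes "rel_decidable k P" shows "rel_decidable k (\<lambda>f xs. \<not> P f xs)"
proof -
  have "(if \<not> P f xs then 0 else 1) = (if P f xs then 1 else (0::nat))" for f xs by simp
  then show ?thesis
    using rel_computable_if[OF assms rel_computable_const rel_computable_const, of 1 0]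
    unfolding rel_decidable_def by simp
qed

lemma rel_decidable_conj:
  assumes "rel_decidable k P" "rel_decidable k Q" shows "rel_decidable k (\<lambda>f xs. P f xs \<and> Q f xs)"
proof -
  have "(if P f xs \<and> Q f xs then 0 else 1) = (if P f xs then if Q f xs then 0 else 1 else (1::nat))"
    for f xs by simp
  then show ?thesis
    using rel_computable_if[OF assms(1) assms(2)[unfolded rel_decidable_def] rel_computable_const, of 1]
    unfolding rel_decidable_def by simp
qed

lemma rel_decidable_disj:
  assumes "rel_decidable k P" "rel_decidable k Q" shows "rel_decidable k (\<lambda>f xs. P f xs \<or> Q f xs)"
  using rel_decidable_not[OF rel_decidable_conj[OF assms[THEN rel_decidable_not]]] by simp

lemma rel_decidable_imp:
  assumes "rel_decidable k P" "rel_decidable k Q" shows "rel_decidable k (\<lambda>f xs. P f xs \<longrightarrow> Q f xs)"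
  using rel_decidable_disj[OF rel_decidable_not[OF assms(1)] assms(2)] by simp

lemma rel_decidable_eq:
  assumes "rel_computable k X" "rel_computable k Y"
  shows "rel_decidable k (\<lambda>f xs. X f xs = Y f xs)"
  using rel_decidable_conj[OF rel_decidable_le[OF assms] rel_decidable_le[OF assms(2,1)]]
  unfolding order.eq_iff[of "X f xs" "Y f xs" for f xs] .

text \<open>Unbounded search is made total by letting it stop at the bound as well; a witness below
  the bound exists iff the search stops strictly before it.\<close>

lemma rel_decidable_ex_less:
  assumes N: "rel_computable k N" and P: "rel_decidable (Suc k) (\<lambda>f ys. P f (tl ys) (hd ys))"
  shows "rel_decidable k (\<lambda>f xs. \<exists>n<N f xs. P f xs n)"
proof -
  let ?L = "\<lambda>f xs. LEAST n. N f xs \<le> n \<or> P f xs n"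
  have "rel_computable k ?L"
  proof (rule rel_computable_Least)
    have "rel_computable (Suc k) (\<lambda>f ys. hd ys)"
      by (rule rel_computable_vars) simp
    then show "rel_decidable (Suc k) (\<lambda>f ys. N f (tl ys) \<le> hd ys \<or> P f (tl ys) (hd ys))"
      by (intro rel_decidable_disj rel_decidable_le rel_computable_tl[OF N] P)
    show "\<exists>n. N f xs \<le> n \<or> P f xs n" for f xs
      by blast
  qed
  then have "rel_decidable k (\<lambda>f xs. Suc (?L f xs) \<le> N f xs)"
    using N by (intro rel_decidable_le rel_computable_Suc)
  moreover have "Suc (?L f xs) \<le> N f xs \<longleftrightarrow> (\<exists>n<N f xs. P f xs n)" for f xs
  proof
    assume "Suc (?L f xs) \<le> N f xs"
    moreover have "N f xs \<le> ?L f xs \<or> P f xs (?L f xs)" by (rule LeastI[of _ "N f xs"]) simp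
    ultimately show "\<exists>n<N f xs. P f xs n" by (intro exI[of _ "?L f xs"]) simp
  next
    assume "\<exists>n<N f xs. P f xs n"
    then obtain n where n: "n < N f xs" "P f xs n" by blast
    then have "?L f xs \<le> n" by (intro Least_le) simp
    with n show "Suc (?L f xs) \<le> N f xs" by simp
  qed
  ultimately show ?thesis by simp
qed

lemma rel_decidable_ex_le:
  assumes "rel_computable k N" "rel_decidable (Suc k) (\<lambda>f ys. P f (tl ys) (hd ys))"
  shows "rel_decidable k (\<lambda>f xs. \<exists>n\<le>N f xs. P f xs n)"
  using rel_decidable_ex_less[OF rel_computable_Suc[OF assms(1)] assms(2)]
  by (simp add: less_Suc_eq_le)

lemma rel_decidable_all_less:
  assumes "rel_computable k N" "rel_decidable (Suc k) (\<lambda>f ys. P f (tl ys) (hd ys))"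
  shows "rel_decidable k (\<lambda>f xs. \<forall>n<N f xs. P f xs n)"
  using rel_decidable_not[OF rel_decidable_ex_less[OF assms(1) rel_decidable_not[OF assms(2)]]]
  by simp

lemmas rel_logic =
  rel_decidable_le rel_decidable_eq rel_decidable_not rel_decidable_conj rel_decidable_disj
  rel_decidable_imp rel_decidable_ex_less rel_decidable_ex_le rel_decidable_all_less
  rel_computable_const rel_computable_vars rel_computable_Suc rel_computable_query
  rel_computable_add rel_computable_mult rel_computable_diff rel_computable_power rel_computable_if

section \<open>Computing with codes of pairs, finite sets and lists\<close>

lemma rel_computable_prod_encode:
  assumes "rel_computable k X" "rel_computable k Y"
  shows "rel_computable k (\<lambda>f xs. prod_encode (X f xs, Y f xs))"
proof -
  \<comment> \<open>Cantor pairing is a triangular number plus the first component, and triangular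
    numbers arise by primitive recursion.\<close>
  have "rec_nat 0 (\<lambda>n r. r + Suc n) x = triangle x" for x
    by (induction x) simp_all
  then have "prod_encode (x, y) = rec_nat 0 (\<lambda>n r. r + Suc n) (x + y) + x" for x y
    by (simp add: prod_encode_def)
  moreover have "rel_computable k (\<lambda>f xs. rec_nat 0 (\<lambda>n r. r + Suc n) (X f xs + Y f xs) + X f xs)"
    using assms by (intro rel_computable_rec rel_logic) simp_all
  ultimately show ?thesis by simp
qed

text \<open>Unpairing by search: the first component is the only \<open>a\<close> that has a partner
  \<open>b\<close>, and \<open>b\<close> never exceeds the code, so the test uses a bounded
  quantifier only.\<close>

lemma rel_computable_fst_prod_decode:
  assumes "rel_computable k X" shows "rel_computable k (\<lambda>f xs. fst (prod_decode (X f xs)))"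
proof (rule rel_computable_comp1[where G = "\<lambda>f n. fst (prod_decode n)", OF _ assms])
  have "(LEAST a. \<exists>b\<le>n. prod_encode (a, b) = n) = fst (prod_decode n)" for n
  proof -
    obtain a b where n: "n = prod_encode (a, b)" by (metis prod_decode_inverse surj_pair)
    then show ?thesis by (auto simp: le_prod_encode_2 intro!: Least_equality)
  qed
  moreover have "rel_computable 1 (\<lambda>f xs. LEAST a. \<exists>b\<le>hd xs. prod_encode (a, b) = hd xs)"
  proof (rule rel_computable_Least)
    show "\<exists>a. \<exists>b\<le>hd xs. prod_encode (a, b) = hd xs" for xs :: "nat list"
      by (metis le_prod_encode_2 prod_decode_inverse surj_pair)
  qed (intro rel_logic rel_computable_prod_encode; simp)
  ultimately show "rel_computable 1 (\<lambda>f xs. fst (prod_decode (hd xs)))" by simp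
qed

lemma rel_computable_snd_prod_decode:
  assumes "rel_computable k X" shows "rel_computable k (\<lambda>f xs. snd (prod_decode (X f xs)))"
proof (rule rel_computable_comp1[where G = "\<lambda>f n. snd (prod_decode n)", OF _ assms])
  have "(LEAST b. \<exists>a\<le>n. prod_encode (a, b) = n) = snd (prod_decode n)" for n
  proof -
    obtain a b where n: "n = prod_encode (a, b)" by (metis prod_decode_inverse surj_pair)
    then show ?thesis by (auto simp: le_prod_encode_1 intro!: Least_equality)
  qed
  moreover have "rel_computable 1 (\<lambda>f xs. LEAST b. \<exists>a\<le>hd xs. prod_encode (a, b) = hd xs)"
  proof (rule rel_computable_Least)
    show "\<exists>b. \<exists>a\<le>hd xs. prod_encode (a, b) = hd xs" for xs :: "nat list"
      by (metis le_prod_encode_1 prod_decode_inverse surj_pair)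
  qed (intro rel_logic rel_computable_prod_encode; simp)
  ultimately show "rel_computable 1 (\<lambda>f xs. snd (prod_decode (hd xs)))" by simp
qed

lemma rel_decidable_mem:
  assumes "rel_computable k X" "rel_computable k Y"
  shows "rel_decidable k (\<lambda>f xs. X f xs \<in> set_decode (Y f xs))"
proof (rule rel_decidable_comp2[where Q = "\<lambda>f m c. m \<in> set_decode c", OF _ assms])
  \<comment> \<open>Membership means that the binary digit of \<open>c\<close> at position
    \<open>m\<close> is 1: \<open>2 * q + 1\<close> collects the digits from position
    \<open>m\<close> upwards and \<open>r\<close> those below it.\<close>
  have "m \<in> set_decode c \<longleftrightarrow> (\<exists>q\<le>c. \<exists>r<2 ^ m. c = (2 * q + 1) * 2 ^ m + r)" for m c :: nat
  proof
    assume "m \<in> set_decode c"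
    then have "odd (c div 2 ^ m)" by (simp add: set_decode_def)
    then obtain q where q: "c div 2 ^ m = 2 * q + 1" by (elim oddE)
    have c: "c = (2 * q + 1) * 2 ^ m + c mod 2 ^ m" by (metis q div_mult_mod_eq)
    have "q \<le> c" using q div_le_dividend[of c "2 ^ m"] by linarith
    then show "\<exists>q\<le>c. \<exists>r<2 ^ m. c = (2 * q + 1) * 2 ^ m + r"
      using c by (metis mod_less_divisor pos2 zero_less_power)
  next
    assume "\<exists>q\<le>c. \<exists>r<2 ^ m. c = (2 * q + 1) * 2 ^ m + r"
    then obtain q r where qr: "r < 2 ^ m" "c = (2 * q + 1) * 2 ^ m + r" by blast
    have "((2 * q + 1) * 2 ^ m + r) div 2 ^ m = 2 * q + 1 + r div 2 ^ m"
      by (rule div_mult_self3) simp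
    with qr have "c div 2 ^ m = 2 * q + 1" by simp
    then show "m \<in> set_decode c" by (simp add: set_decode_def)
  qed
  moreover have "rel_decidable 2 (\<lambda>f xs. \<exists>q\<le>hd (tl xs). \<exists>r<2 ^ hd xs. hd (tl xs) = (2 * q + 1) * 2 ^ hd xs + r)"
    by (intro rel_logic; simp)
  ultimately show "rel_decidable 2 (\<lambda>f xs. hd xs \<in> set_decode (hd (tl xs)))" by simp
qed

text \<open>As \<open>c < 2 ^ c\<close>, all binary digits of \<open>c\<close> at positions from
  \<open>c\<close> on vanish. This turns quantifiers over a decoded set into bounded ones.\<close>

lemma mem_set_decode_less: "m \<in> set_decode c \<Longrightarrow> m < c"
proof (rule ccontr)
  assume m: "m \<in> set_decode c" and "\<not> m < c"
  then have "c < 2 ^ m" by (metis less_exp le_less_trans not_less)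
  with m show False by (simp add: set_decode_def)
qed

lemma rel_decidable_ball_set_decode:
  assumes "rel_computable k C" "rel_decidable (Suc k) (\<lambda>f ys. P f (tl ys) (hd ys))"
  shows "rel_decidable k (\<lambda>f xs. \<forall>n\<in>set_decode (C f xs). P f xs n)"
proof -
  have "rel_decidable (Suc k) (\<lambda>f ys. hd ys \<in> set_decode (C f (tl ys)) \<longrightarrow> P f (tl ys) (hd ys))"
    by (intro rel_decidable_imp rel_decidable_mem rel_computable_vars rel_computable_tl assms) simp
  then have "rel_decidable k (\<lambda>f xs. \<forall>n<C f xs. n \<in> set_decode (C f xs) \<longrightarrow> P f xs n)"
    by (rule rel_decidable_all_less[OF assms(1)])
  moreover have "(\<forall>n<c. n \<in> set_decode c \<longrightarrow> Q n) \<longleftrightarrow> (\<forall>n\<in>set_decode c. Q n)" for c Q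
    using mem_set_decode_less by blast
  ultimately show ?thesis by simp
qed

lemmas rel_coding =
  rel_computable_prod_encode rel_computable_fst_prod_decode rel_computable_snd_prod_decode
  rel_decidable_mem rel_decidable_ball_set_decode

text \<open>The length \<open>n\<close> is fixed outside the program, so induction on it unrolls the
  test and no recursion over coded lists has to be programmed. A nonempty list is coded as the
  successor of a pair of head and coded tail; \<open>X\<close> varies because the induction
  hypothesis is applied to the tail.\<close>

lemma rel_decidable_length_list_decode:
  assumes "rel_computable k X"
  shows "rel_decidable k (\<lambda>f xs. length (list_decode (X f xs)) = n)"
  using assms
proof (induction n arbitrary: X)
  case 0
  have "length (list_decode l) = 0 \<longleftrightarrow> l = 0" for l
    by (cases l) (auto split: prod.splits)
  then show ?case using 0 by (simp only:) (intro rel_logic)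
next
  case (Suc n)
  have "length (list_decode l) = Suc n \<longleftrightarrow>
      1 \<le> l \<and> length (list_decode (snd (prod_decode (l - 1)))) = n" for l
    by (cases l) (simp_all add: case_prod_beta)
  moreover have "rel_decidable k (\<lambda>f xs. 1 \<le> X f xs \<and>
      length (list_decode (snd (prod_decode (X f xs - 1)))) = n)"
    by (intro rel_decidable_conj Suc.IH rel_decidable_le rel_computable_const
        rel_computable_snd_prod_decode rel_computable_diff Suc.prems)
  ultimately show ?case by simp
qed

section \<open>A criterion for enumeration reducibility\<close>

lemma enumerates_mem_iff: "enumerates e S \<Longrightarrow> c \<in> S \<longleftrightarrow> (\<exists>k. e k = Suc c)"
  unfolding enumerates_def by (simp add: image_iff eq_commute)

text \<open>Dovetailing: step \<open>n\<close> of the output decodes \<open>n\<close> into a stage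
  \<open>k\<close> and a candidate \<open>c\<close>, lists \<open>c\<close> if the decidable test
  succeeds at stage \<open>k\<close>, and is silent otherwise. Every pair has a code, so each
  candidate is tried at every stage.\<close>

lemma enum_reducible_if_rel_decidable:
  assumes P: "rel_decidable 2 (\<lambda>f xs. P f (hd xs) (hd (tl xs)))"
    and S: "\<And>e. enumerates e T \<Longrightarrow> S = {c. \<exists>k. P e k c}"
  shows "enum_reducible S T"
proof -
  define \<Phi> where "\<Phi> f n = (if P f (fst (prod_decode n)) (snd (prod_decode n))
    then Suc (snd (prod_decode n)) else 0)" for f n
  have "rel_computable 1 (\<lambda>f xs. \<Phi> f (hd xs))"
    unfolding \<Phi>_def
    by (intro rel_computable_if rel_decidable_comp2[where Q = P, OF P] rel_computable_Suc
        rel_computable_const rel_computable_fst_prod_decode rel_computable_snd_prod_decode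
        rel_computable_vars) simp_all
  then obtain p where "computes f p xs (\<Phi> f (hd xs))" if "length xs = 1" for f xs
    unfolding rel_computable_def by blast
  from this[of "[_]"] have "computable_on {e. enumerates e T} \<Phi>"
    unfolding computable_on_def by auto
  moreover have "enumerates (\<Phi> e) S" if "enumerates e T" for e
  proof -
    have "(\<exists>n. \<Phi> e n = Suc c) \<longleftrightarrow> (\<exists>k. P e k c)" for c
    proof
      assume "\<exists>n. \<Phi> e n = Suc c"
      then show "\<exists>k. P e k c" by (auto simp: \<Phi>_def split: if_splits)
    next
      assume "\<exists>k. P e k c"
      then obtain k where "P e k c" ..
      then have "\<Phi> e (prod_encode (k, c)) = Suc c" by (simp add: \<Phi>_def)
      then show "\<exists>n. \<Phi> e n = Suc c" ..
    qed
    then show ?thesis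
      unfolding enumerates_def S[OF that] by (auto simp: image_iff eq_commute[of "Suc _"])
  qed
  ultimately show ?thesis unfolding enum_reducible_def by blast
qed

section \<open>Codes of patterns\<close>

text \<open>Pairs, lists and finite sets are coded bijectively, so every number decodes to a finite
  relation between integer lists and symbols. It remains to test the symbols against the alphabet
  coded by \<open>b\<close>, the lengths of the positions, and, in the last clause, that the
  relation is single-valued.\<close>

definition valid_code :: "nat \<Rightarrow> nat \<Rightarrow> nat \<Rightarrow> bool" where
  "valid_code d b p \<longleftrightarrow> (\<forall>m\<in>set_decode p.
     snd (prod_decode m) \<in> set_decode b \<and> length (list_decode (fst (prod_decode m))) = d \<and>
     (\<forall>m'\<in>set_decode p. fst (prod_decode m') = fst (prod_decode m) \<longrightarrow> m' = m))"

lemma rel_decidable_valid_code: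
  assumes "rel_computable k X" "rel_computable k Y"
  shows "rel_decidable k (\<lambda>f xs. valid_code d (X f xs) (Y f xs))"
proof (rule rel_decidable_comp2[where Q = "\<lambda>f b p. valid_code d b p", OF _ assms])
  show "rel_decidable 2 (\<lambda>f xs. valid_code d (hd xs) (hd (tl xs)))"
    unfolding valid_code_def
    by (intro rel_coding rel_decidable_length_list_decode rel_logic; simp)
qed

lemma valid_code_iff:
  assumes "finite B"
  shows "valid_code d (set_encode B) p \<longleftrightarrow> p \<in> pattern_code ` patterns d B"
proof
  let ?c = "\<lambda>(v, a). prod_encode (list_encode (map int_encode v), a)"
  have inj_c: "inj ?c"
    by (auto intro!: injI simp: list_encode_eq inj_map_eq_map[OF inj_int_encode])
  {
    assume "p \<in> pattern_code ` patterns d B"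
    then obtain q where q: "q \<in> patterns d B" and p: "p = pattern_code q" by blast
    have fin: "finite (Map.graph q)" using q by (auto simp: patterns_def)
    have D: "set_decode p = ?c ` Map.graph q"
      using fin unfolding p pattern_code_def by (simp add: set_encode_inverse)
    have q_iff: "a \<in> B" "length v = d" if "q v = Some a" for v a
      using q that by (auto simp: patterns_def Zgrid_def ran_def dom_def)
    have D_iff: "m \<in> set_decode p \<longleftrightarrow> (\<exists>v a. m = ?c (v, a) \<and> q v = Some a)" for m
      unfolding D Map.graph_def by blast
    show "valid_code d (set_encode B) p"
      unfolding valid_code_def
    proof (intro ballI conjI impI)
      fix m assume "m \<in> set_decode p"
      then obtain v a where m: "m = ?c (v, a)" "q v = Some a" unfolding D_iff by blast
      then show "snd (prod_decode m) \<in> set_decode (set_encode B)"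
        "length (list_decode (fst (prod_decode m))) = d"
        using q_iff[OF m(2)] assms by (simp_all add: set_encode_inverse)
      fix m' assume "m' \<in> set_decode p" and fst: "fst (prod_decode m') = fst (prod_decode m)"
      then obtain v' a' where m': "m' = ?c (v', a')" "q v' = Some a'" unfolding D_iff by blast
      then have "v' = v"
        using fst m by (simp add: list_encode_eq inj_map_eq_map[OF inj_int_encode])
      then show "m' = m" using m m' by simp
    qed
  }
  {
    assume valid: "valid_code d (set_encode B) p"
    let ?D = "set_decode p"
    \<comment> \<open>The pattern read off from the code: each position gets the symbol paired with
      it, which is unique by the last clause of \<open>valid_code\<close>.\<close>
    define q where "q v = (if \<exists>a. ?c (v, a) \<in> ?D then Some (SOME a. ?c (v, a) \<in> ?D) else None)" for v
    have uniq: "a = a'" if "?c (v, a) \<in> ?D" "?c (v, a') \<in> ?D" for v a a'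
    proof -
      have "?c (v, a) = ?c (v, a')"
        using valid[unfolded valid_code_def, rule_format, OF that(2)] that(1) by simp
      then show ?thesis by simp
    qed
    have q: "q v = Some a \<longleftrightarrow> ?c (v, a) \<in> ?D" for v a
    proof (cases "\<exists>a. ?c (v, a) \<in> ?D")
      case True
      then have *: "?c (v, SOME a. ?c (v, a) \<in> ?D) \<in> ?D" by (rule someI_ex)
      have "q v = Some (SOME a. ?c (v, a) \<in> ?D)" using True unfolding q_def by (rule if_P)
      with * obtain s where s: "q v = Some s" "?c (v, s) \<in> ?D" by blast
      show ?thesis
      proof
        assume "q v = Some a"
        with s show "?c (v, a) \<in> ?D" by simp
      next
        assume "?c (v, a) \<in> ?D"
        from uniq[OF s(2) this] s(1) show "q v = Some a" by simp
      qed
    next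
      case False
      then have "q v = None" unfolding q_def by (rule if_not_P)
      then show ?thesis using False by auto
    qed
    have graph: "?c ` Map.graph q = ?D"
    proof
      show "?c ` Map.graph q \<subseteq> ?D" using q by (auto simp: Map.graph_def)
      show "?D \<subseteq> ?c ` Map.graph q"
      proof
        fix m assume m: "m \<in> ?D"
        \<comment> \<open>Every \<open>m\<close> is the code of some cell with its symbol, as all
          the codings are onto; \<open>?v\<close> is the position of that cell.\<close>
        let ?v = "map int_decode (list_decode (fst (prod_decode m)))"
        have "?c (?v, snd (prod_decode m)) = m" by (simp add: comp_def)
        then show "m \<in> ?c ` Map.graph q"
          using m q by (intro image_eqI[of _ _ "(?v, snd (prod_decode m))"]) (auto simp: Map.graph_def)
      qed
    qed
    \<comment> \<open>Finiteness of the domain is inherited from \<open>?D\<close>, into which the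
      graph is coded injectively.\<close>
    have "finite (Map.graph q)"
    proof (rule finite_imageD)
      show "finite (?c ` Map.graph q)" unfolding graph by simp
      show "inj_on ?c (Map.graph q)" using inj_c by (rule inj_on_subset) simp
    qed
    then have "finite (dom q)" by simp
    moreover have "v \<in> Zgrid d \<and> a \<in> B" if "q v = Some a" for v a
    proof -
      have "?c (v, a) \<in> ?D" using that q by blast
      from valid[unfolded valid_code_def, rule_format, OF this] show ?thesis
        using assms by (simp add: Zgrid_def set_encode_inverse)
    qed
    ultimately have "q \<in> patterns d B"
      unfolding patterns_def by (auto simp: ran_def)
    moreover have "pattern_code q = p"
      unfolding pattern_code_def graph by simp
    ultimately show "p \<in> pattern_code ` patterns d B" by blast
  }
qed

lemma valid_code_pattern_code:
  assumes "finite A" "p \<in> patterns d B"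
  shows "valid_code d (set_encode A) (pattern_code p) \<longleftrightarrow> p \<in> patterns d A"
proof -
  \<comment> \<open>Injectivity of \<open>pattern_code\<close> is stated for one alphabet at a time;
    \<open>UNIV\<close> covers both \<open>A\<close> and \<open>B\<close>.\<close>
  have "patterns d A \<subseteq> patterns d UNIV" "p \<in> patterns d UNIV"
    using assms(2) by (auto simp: patterns_def)
  then show ?thesis
    using valid_code_iff[OF assms(1)] inj_on_image_mem_iff[OF inj_on_pattern_code] by blast
qed

section \<open>Inclusion in an SFT\<close>

text \<open>The single cell is the origin; as appearance is up to shifts, forbidding this pattern
  bans the symbol from every cell.\<close>

definition symbol_pattern :: "nat \<Rightarrow> nat \<Rightarrow> pattern" where
  "symbol_pattern d a = [replicate d 0 \<mapsto> a]"

lemma symbol_pattern_in_patterns: "a \<in> A \<Longrightarrow> symbol_pattern d a \<in> patterns d A"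
  by (simp add: symbol_pattern_def patterns_def Zgrid_def)

text \<open>The code of a singleton set is a power of two. This explicit form makes the code visibly
  computable from \<open>a\<close>.\<close>

lemma pattern_code_symbol_pattern:
  "pattern_code (symbol_pattern d a) =
     2 ^ prod_encode (list_encode (map int_encode (replicate d 0)), a)"
proof -
  have "Map.graph (symbol_pattern d a) = {(replicate d 0, a)}"
    by (auto simp: Map.graph_def symbol_pattern_def split: if_splits)
  then show ?thesis by (simp add: pattern_code_def set_encode_def)
qed

text \<open>Pointwise form of appearance. The hypothesis keeps the cells of \<open>p\<close> inside
  the grid, where \<open>shift\<close> is given by its formula.\<close>

lemma appears_iff:
  assumes "dom p \<subseteq> Zgrid d"
  shows "appears d p x \<longleftrightarrow> (\<exists>u\<in>Zgrid d. \<forall>v a. p v = Some a \<longrightarrow> x (map2 (+) v u) = a)"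
proof -
  have "(Some \<circ> shift d u x) |` dom p = p \<longleftrightarrow> (\<forall>v a. p v = Some a \<longrightarrow> x (map2 (+) v u) = a)" for u
  proof
    assume eq: "(Some \<circ> shift d u x) |` dom p = p"
    show "\<forall>v a. p v = Some a \<longrightarrow> x (map2 (+) v u) = a"
    proof (intro allI impI)
      fix v a assume v: "p v = Some a"
      then have "((Some \<circ> shift d u x) |` dom p) v = Some (x (map2 (+) v u))"
        using assms by (auto simp: restrict_map_def shift_def)
      with v show "x (map2 (+) v u) = a" by (simp add: eq)
    qed
  next
    assume *: "\<forall>v a. p v = Some a \<longrightarrow> x (map2 (+) v u) = a"
    show "(Some \<circ> shift d u x) |` dom p = p"
    proof
      fix v show "((Some \<circ> shift d u x) |` dom p) v = p v"
        using assms * by (cases "p v") (auto simp: restrict_map_def shift_def)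
    qed
  qed
  then show ?thesis unfolding appears_def by simp
qed

lemma map2_add_replicate_0: "map2 (+) (replicate (length u) 0) u = (u :: int list)"
  by (induction u) auto

lemma appears_symbol_pattern: "appears d (symbol_pattern d a) x \<longleftrightarrow> (\<exists>u\<in>Zgrid d. x u = a)"
proof -
  have "appears d (symbol_pattern d a) x \<longleftrightarrow> (\<exists>u\<in>Zgrid d. x (map2 (+) (replicate d 0) u) = a)"
    by (subst appears_iff) (auto simp: symbol_pattern_def Zgrid_def)
  moreover have "map2 (+) (replicate d 0) u = u" if "u \<in> Zgrid d" for u
    using that map2_add_replicate_0[of u] by (simp add: Zgrid_def)
  ultimately show ?thesis by simp
qed

text \<open>Every symbol of an appearing pattern is a value of \<open>x\<close>. Hence forbidden
  patterns with a symbol outside \<open>A\<close> impose nothing on configurations over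
  \<open>A\<close>.\<close>

lemma appears_ran_subset:
  assumes "dom p \<subseteq> Zgrid d" "x \<in> Zgrid d \<rightarrow>\<^sub>E A" "appears d p x"
  shows "ran p \<subseteq> A"
proof
  fix a assume "a \<in> ran p"
  then obtain v where v: "p v = Some a" by (auto simp: ran_def)
  obtain u where "u \<in> Zgrid d" "x (map2 (+) v u) = a"
    using assms(3) v unfolding appears_iff[OF assms(1)] by blast
  moreover from this have "map2 (+) v u \<in> Zgrid d"
    using assms(1) v by (auto simp: Zgrid_def)
  ultimately show "a \<in> A" using assms(2) by (auto simp: PiE_iff)
qed

text \<open>The alphabet of the SFT acts as a further set of forbidden patterns: every symbol of \<open>A\<close> that is
  missing from it must not occur in \<open>Y\<close>.\<close>

lemma subset_sft_iff:
  assumes Y: "Y \<subseteq> Zgrid d \<rightarrow>\<^sub>E A" and F: "F \<subseteq> patterns d B"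
  shows "Y \<subseteq> sft d (B, F) \<longleftrightarrow>
    (\<forall>p\<in>F. p \<in> patterns d A \<longrightarrow> p \<notin> language d A Y) \<and>
    (\<forall>a\<in>A. a \<in> B \<or> symbol_pattern d a \<notin> language d A Y)"
proof -
  have "(\<forall>p\<in>F. p \<in> patterns d A \<longrightarrow> p \<notin> language d A Y) \<longleftrightarrow> (\<forall>x\<in>Y. \<forall>p\<in>F. \<not> appears d p x)"
  proof -
    have "p \<in> patterns d A" if "p \<in> F" "x \<in> Y" "appears d p x" for p x
    proof -
      have "finite (dom p)" "dom p \<subseteq> Zgrid d" using that(1) F unfolding patterns_def by blast+
      moreover have "x \<in> Zgrid d \<rightarrow>\<^sub>E A" using that(2) Y by blast
      ultimately show ?thesis
        using appears_ran_subset that(3) unfolding patterns_def by blast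
    qed
    then show ?thesis unfolding language_def by blast
  qed
  moreover have "(\<forall>a\<in>A. a \<in> B \<or> symbol_pattern d a \<notin> language d A Y) \<longleftrightarrow> Y \<subseteq> Zgrid d \<rightarrow>\<^sub>E B"
  proof -
    have "symbol_pattern d a \<in> language d A Y \<longleftrightarrow> (\<exists>x\<in>Y. \<exists>u\<in>Zgrid d. x u = a)" if "a \<in> A" for a
      using symbol_pattern_in_patterns[OF that] unfolding language_def
      by (simp add: appears_symbol_pattern)
    moreover have "x u \<in> A" if "x \<in> Y" "u \<in> Zgrid d" for x u
      using that Y by (auto simp: PiE_iff)
    moreover have "Y \<subseteq> Zgrid d \<rightarrow>\<^sub>E B \<longleftrightarrow> (\<forall>x\<in>Y. \<forall>u\<in>Zgrid d. x u \<in> B)"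
      using Y by (auto simp: PiE_iff)
    ultimately show ?thesis by blast
  qed
  moreover have "Y \<subseteq> sft d (B, F) \<longleftrightarrow> (\<forall>x\<in>Y. \<forall>p\<in>F. \<not> appears d p x) \<and> Y \<subseteq> Zgrid d \<rightarrow>\<^sub>E B"
    unfolding sft_def by blast
  ultimately show ?thesis by simp
qed

text \<open>The inclusion criterion carried over to codes by injectivity of
  \<open>pattern_code\<close>; \<open>valid_code\<close> for \<open>A\<close> selects the forbidden
  patterns that are patterns over \<open>A\<close>.\<close>

lemma subset_sft_iff_codes:
  assumes "finite A" "Y \<subseteq> Zgrid d \<rightarrow>\<^sub>E A" "F \<subseteq> patterns d B"
  defines "T \<equiv> pattern_code ` (patterns d A - language d A Y)"
  shows "Y \<subseteq> sft d (B, F) \<longleftrightarrow>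
    (\<forall>p\<in>pattern_code ` F. valid_code d (set_encode A) p \<longrightarrow> p \<in> T) \<and>
    (\<forall>a\<in>A. a \<in> B \<or> pattern_code (symbol_pattern d a) \<in> T)"
proof -
  have T: "pattern_code p \<in> T \<longleftrightarrow> p \<notin> language d A Y" if "p \<in> patterns d A" for p
    using that inj_on_image_mem_iff[OF inj_on_pattern_code that] unfolding T_def by blast
  have "valid_code d (set_encode A) (pattern_code p) \<longleftrightarrow> p \<in> patterns d A" if "p \<in> F" for p
    using valid_code_pattern_code assms(1,3) that by blast
  then have "(\<forall>p\<in>pattern_code ` F. valid_code d (set_encode A) p \<longrightarrow> p \<in> T) \<longleftrightarrow>
      (\<forall>p\<in>F. p \<in> patterns d A \<longrightarrow> p \<notin> language d A Y)"
    using T by simp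
  moreover have "pattern_code (symbol_pattern d a) \<in> T \<longleftrightarrow> symbol_pattern d a \<notin> language d A Y"
    if "a \<in> A" for a
    using T symbol_pattern_in_patterns[OF that] .
  ultimately show ?thesis
    unfolding subset_sft_iff[OF assms(2,3)] by simp
qed

text \<open>Every number decodes to a finite alphabet and a finite set of numbers. It is a
  presentation iff these numbers are pattern codes over that alphabet, which is the first
  \<open>valid_code\<close> condition; the other conditions express the inclusion of
  \<open>Y\<close>.\<close>

lemma presentation_code_image_iff:
  assumes "finite A" "Y \<subseteq> Zgrid d \<rightarrow>\<^sub>E A"
  defines "T \<equiv> pattern_code ` (patterns d A - language d A Y)"
  shows "c \<in> presentation_code ` {X \<in> sft_presentations d. Y \<subseteq> sft d X} \<longleftrightarrow>
    (\<forall>p\<in>set_decode (snd (prod_decode c)).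
      valid_code d (fst (prod_decode c)) p \<and> (valid_code d (set_encode A) p \<longrightarrow> p \<in> T)) \<and>
    (\<forall>a\<in>A. a \<in> set_decode (fst (prod_decode c)) \<or> pattern_code (symbol_pattern d a) \<in> T)"
    (is "_ \<longleftrightarrow> ?R")
proof
  assume "c \<in> presentation_code ` {X \<in> sft_presentations d. Y \<subseteq> sft d X}"
  then obtain B F where BF: "finite B" "finite F" "F \<subseteq> patterns d B" "Y \<subseteq> sft d (B, F)"
    and c: "c = presentation_code (B, F)"
    by (auto simp: sft_presentations_def)
  then have "prod_decode c = (set_encode B, set_encode (pattern_code ` F))"
    by (simp add: presentation_code_def)
  then show ?R
    using BF valid_code_iff[of B d] subset_sft_iff_codes[OF assms(1,2) BF(3)]
    unfolding T_def by (auto simp: set_encode_inverse)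
next
  assume R: ?R
  define B where "B = set_decode (fst (prod_decode c))"
  have "valid_code d (set_encode B) p" if "p \<in> set_decode (snd (prod_decode c))" for p
    using R that by (simp add: B_def)
  then have "set_decode (snd (prod_decode c)) \<subseteq> pattern_code ` patterns d B"
    using valid_code_iff[of B d] by (auto simp: B_def)
  \<comment> \<open>The decoded numbers are finitely many pattern codes, so they are the codes of a
    finite set of patterns.\<close>
  then obtain F where F: "F \<subseteq> patterns d B" "finite F"
    "set_decode (snd (prod_decode c)) = pattern_code ` F"
    using finite_subset_image[OF finite_set_decode] by metis
  have "Y \<subseteq> sft d (B, F)"
    by (subst subset_sft_iff_codes[OF assms(1,2) F(1)])
      (use R in \<open>simp add: F(3) T_def B_def\<close>)
  moreover have "presentation_code (B, F) = c"
    by (simp add: presentation_code_def B_def flip: F(3))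
  moreover have "(B, F) \<in> sft_presentations d"
    using F by (simp add: sft_presentations_def B_def)
  ultimately show "c \<in> presentation_code ` {X \<in> sft_presentations d. Y \<subseteq> sft d X}"
    by (metis (mono_tags, lifting) image_eqI mem_Collect_eq)
qed

section \<open>The two reductions\<close>

text \<open>Each element of \<open>T\<close> in the finite set \<open>D\<close> is listed at some
  step, and the maximum of these steps serves all of them. A single stage thus witnesses finitely
  many memberships.\<close>

lemma enumerates_finite_stage:
  assumes "enumerates e T" "finite D"
  shows "\<exists>k. \<forall>x\<in>D. x \<in> T \<longrightarrow> (\<exists>i\<le>k. e i = Suc x)"
  using assms(2)
proof (induction D)
  case (insert x D)
  then obtain k where k: "\<forall>y\<in>D. y \<in> T \<longrightarrow> (\<exists>i\<le>k. e i = Suc y)" by blast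
  obtain j where "x \<in> T \<longrightarrow> e j = Suc x"
    using enumerates_mem_iff[OF assms(1)] by blast
  with k show ?case
    by (intro exI[of _ "max j k"]) (metis insertE le_max_iff_disj max.cobounded1)
qed simp

lemma enum_reducible_sfts_language:
  assumes A: "finite A" and Y: "Y \<subseteq> Zgrid d \<rightarrow>\<^sub>E A"
  shows "enum_reducible
    (presentation_code ` {X \<in> sft_presentations d. Y \<subseteq> sft d X})
    (pattern_code ` (patterns d A - language d A Y))"
    (is "enum_reducible ?S ?T")
proof -
  let ?z = "list_encode (map int_encode (replicate d 0))"
  \<comment> \<open>The characterization of the codes of SFTs containing \<open>Y\<close>, with
    membership in the complement of the language replaced by being listed up to step
    \<open>k\<close>. \<open>A\<close> is fixed, so \<open>set_encode A\<close> and
    \<open>?z\<close> enter the program as constants.\<close>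
  define P where "P f k c \<longleftrightarrow>
    (\<forall>p\<in>set_decode (snd (prod_decode c)).
      valid_code d (fst (prod_decode c)) p \<and>
      (valid_code d (set_encode A) p \<longrightarrow> (\<exists>i\<le>k. f i = Suc p))) \<and>
    (\<forall>a\<in>set_decode (set_encode A). a \<in> set_decode (fst (prod_decode c)) \<or>
      (\<exists>i\<le>k. f i = Suc (2 ^ prod_encode (?z, a))))" for f and k c :: nat
  show ?thesis
  proof (rule enum_reducible_if_rel_decidable)
    show "rel_decidable 2 (\<lambda>f xs. P f (hd xs) (hd (tl xs)))"
      unfolding P_def by (intro rel_coding rel_decidable_valid_code rel_logic; simp)
    fix e assume e: "enumerates e ?T"
    have "c \<in> ?S \<longleftrightarrow> (\<exists>k. P e k c)" for c
    proof -
      define T where "T = ?T"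
      let ?sym = "\<lambda>a. pattern_code (symbol_pattern d a)"
      \<comment> \<open>All codes about which the criterion for \<open>c\<close> asks: a finite set,
        so one stage settles it.\<close>
      let ?D = "set_decode (snd (prod_decode c)) \<union> ?sym ` A"
      have S: "c \<in> ?S \<longleftrightarrow>
        (\<forall>p\<in>set_decode (snd (prod_decode c)). valid_code d (fst (prod_decode c)) p \<and>
          (valid_code d (set_encode A) p \<longrightarrow> p \<in> T)) \<and>
        (\<forall>a\<in>A. a \<in> set_decode (fst (prod_decode c)) \<or> ?sym a \<in> T)"
        unfolding T_def by (rule presentation_code_image_iff[OF A Y])
      have P: "P e k c \<longleftrightarrow>
        (\<forall>p\<in>set_decode (snd (prod_decode c)). valid_code d (fst (prod_decode c)) p \<and>
          (valid_code d (set_encode A) p \<longrightarrow> (\<exists>i\<le>k. e i = Suc p))) \<and>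
        (\<forall>a\<in>A. a \<in> set_decode (fst (prod_decode c)) \<or> (\<exists>i\<le>k. e i = Suc (?sym a)))" for k
        unfolding P_def set_encode_inverse[OF A] pattern_code_symbol_pattern ..
      have "finite ?D" using A by simp
      then obtain k where k: "\<forall>x\<in>?D. x \<in> T \<longrightarrow> (\<exists>i\<le>k. e i = Suc x)"
        using enumerates_finite_stage[OF e] unfolding T_def by metis
      show ?thesis
      proof
        assume "c \<in> ?S"
        with k have "P e k c" unfolding S P by (meson UnI1 UnI2 imageI)
        then show "\<exists>k. P e k c" ..
      next
        assume "\<exists>k. P e k c"
        then obtain k where "P e k c" ..
        \<comment> \<open>Conversely, whatever is listed at any stage lies in \<open>T\<close>, so a
          successful test is never wrong.\<close>
        moreover have "x \<in> T" if "\<exists>i\<le>k. e i = Suc x" for x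
          using enumerates_mem_iff[OF e] that unfolding T_def by metis
        ultimately show "c \<in> ?S" unfolding S P by meson
      qed
    qed
    then show "?S = {c. \<exists>k. P e k c}" by (intro set_eqI) (simp only: mem_Collect_eq)
  qed
qed

lemma enum_reducible_language_sfts:
  assumes A: "finite A" and Y: "Y \<subseteq> Zgrid d \<rightarrow>\<^sub>E A"
  shows "enum_reducible
    (pattern_code ` (patterns d A - language d A Y))
    (presentation_code ` {X \<in> sft_presentations d. Y \<subseteq> sft d X})"
    (is "enum_reducible ?T ?S")
proof (rule enum_reducible_if_rel_decidable)
  \<comment> \<open>\<open>2 ^ c\<close> codes the set \<open>{c}\<close>, so the queried value
    announces the presentation with alphabet \<open>A\<close> and the pattern coded by
    \<open>c\<close> as the only forbidden one.\<close>
  show "rel_decidable 2 (\<lambda>f xs. f (hd xs) = Suc (prod_encode (set_encode A, 2 ^ hd (tl xs))))"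
    by (intro rel_coding rel_logic; simp)
  fix e assume e: "enumerates e ?S"
  \<comment> \<open>With alphabet \<open>A\<close> the condition on missing symbols holds trivially,
    and a \<open>c\<close> that codes no pattern over \<open>A\<close> is rejected on both
    sides.\<close>
  have "c \<in> ?T \<longleftrightarrow> prod_encode (set_encode A, 2 ^ c) \<in> ?S" for c
  proof -
    have "set_decode (2 ^ c) = {c}"
      using set_encode_inverse[of "{c}"] by (simp add: set_encode_def)
    then show ?thesis
      unfolding presentation_code_image_iff[OF A Y]
      using valid_code_iff[OF A, of d c] by (auto simp: set_encode_inverse[OF A])
  qed
  then show "?T = {c. \<exists>k. e k = Suc (prod_encode (set_encode A, 2 ^ c))}"
    by (intro set_eqI) (simp only: mem_Collect_eq enumerates_mem_iff[OF e])
qed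

theorem theorem4p1:
  fixes d :: nat and A :: "nat set" and Y :: "config set"
  assumes "d \<ge> 1" and "finite A" and "subshift d A Y"
  shows "enum_equivalent
    (presentation_code ` {X \<in> sft_presentations d. Y \<subseteq> sft d X})
    (pattern_code ` (patterns d A - language d A Y))"
proof -
  \<comment> \<open>A closed set lies in the space carrying the topology, here the set of all
    configurations over \<open>A\<close>.\<close>
  have "Y \<subseteq> Zgrid d \<rightarrow>\<^sub>E A"
    using assms(3) closedin_subset unfolding subshift_def by fastforce
  then show ?thesis
    using assms(2) enum_reducible_sfts_language enum_reducible_language_sfts
    unfolding enum_equivalent_def by blast
qed

end
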